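(* Let $\mathbb{T}$ be a time scale, $\alpha\in[0,1]$, $a,b\in\mathbb{R}$, and $t_0\in\mathbb{T}^{\kappa}$. Let $\kappa_0,\kappa_1$ be an admissible pair on $\mathbb{T}$ with $1+\mu(t)\frac{\kappa_1(\alpha,t)}{\kappa_0(\alpha,t)}\neq0$ for all $t\in\mathbb{T}^\kappa$, and such that the functions $\kappa_i(\alpha,t)$, $i=0,1$, are $\Delta$-differentiable with respect to $t$ and continuous with respect to $\alpha$. Let $\Delta^{\alpha}f=\kappa_1(\alpha,\cdot)f+\kappa_0(\alpha,\cdot)f^{\Delta}$, and let $L:C^2_{rd}\to C_{rd}$ be the operator $$L(y)(t)=\Delta^{\alpha}\Delta^{\alpha}y(t)+a\Delta^{\alpha}y(t)+by(t),\qquad t\in\mathbb{T}^{\kappa^2}_{[t_0,\infty)}.$$ Assume the regressivity condition $$\kappa_0^{2}-\mu\kappa_0(a+2\kappa_1)+\mu^{2}(b+a\kappa_1+\kappa_1^{2})\neq0\quad\text{for all }t\in\mathbb{T}^{\kappa},$$ where $\kappa_i=\kappa_i(\alpha,t)$, $\mu=\mu(t)$. If $Ly(t)=0$ admits two solutions $y_1$ and $y_2$ with $y_1(t)\Delta^{\alpha}y_2(t)\neq\Delta^{\alpha}y_1(t)\,y_2(t)$ for all $t\in\mathbb{T}^{\kappa^{2}}_{[t_0,\infty)}$, then the initial value problem $$Ly(t)=0,\qquad y(t_0)=y_0,\qquad \Delta^{\alpha}y(t_0)=y_0^{\alpha},$$ where $y_0$ and $y_0^{\alpha}$ are given constants,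 has a unique solution defined on $\mathbb{T}_{[t_0,\infty)}$.
   Context: A time scale $\mathbb{T}$ is a nonempty closed subset of $\mathbb{R}$, with forward jump $\sigma(t)=\inf\{s\in\mathbb{T}:s>t\}$, backward jump $\rho(t)=\sup\{s\in\mathbb{T}:s<t\}$ (usual conventions $\inf\emptyset=\sup\mathbb{T}$, $\sup\emptyset=\inf\mathbb{T}$) and graininess $\mu(t)=\sigma(t)-t$. A point $t$ is right-dense if $t<\sup\mathbb{T}$ and $\sigma(t)=t$, left-dense if $t>\inf\mathbb{T}$ and $\rho(t)=t$, left-scattered if $\rho(t)<t$. $\mathbb{T}^{\kappa}=\mathbb{T}\setminus\{m\}$ if $\mathbb{T}$ has a left-scattered maximum $m$, and $\mathbb{T}^{\kappa}=\mathbb{T}$ otherwise; $\mathbb{T}^{\kappa^2}=(\mathbb{T}^\kappa)^\kappa$. A subscript $[t_0,\infty)$ denotes intersection with $[t_0,\infty)$. Delta derivative: for $t\in\mathbb{T}^\kappa$, $f^{\Delta}(t)$ is the number (if it exists) such that for every $\epsilon>0$ there is $\delta>0$ with $|[f(\sigma(t))-f(s)]-f^{\Delta}(t)[\sigma(t)-s]|\le\epsilon|\sigma(t)-s|$ for all $s\in(t-\delta,t+\delta)\cap\mathbb{T}$. A function on $\mathbb{T}$ is rd-continuous if it is continuous at right-dense points and has finite left-sided limits at left-dense points; $C_{rd}$ is the set of rd-continuous functions, and $C^2_{rd}$ (standard notation) the set of twice $\Delta$-differentiable functions with rd-continuous second delta derivative. A function $k:[0,1]\times\mathbb{T}\to[0,\infty)$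 is rd-continuous if $k(\alpha,\cdot)$ is rd-continuous for every $\alpha\in[0,1]$ and $k(\cdot,t)$ is continuous on $[0,1]$ for every $t\in\mathbb{T}$. Admissible pair: rd-continuous $\kappa_0,\kappa_1:[0,1]\times\mathbb{T}\to[0,\infty)$ such that for all $t\in\mathbb{T}$: $\lim_{\alpha\to0^+}\kappa_1(\alpha,t)=1$, $\lim_{\alpha\to0^+}\kappa_0(\alpha,t)=0$, $\lim_{\alpha\to1^-}\kappa_1(\alpha,t)=0$, $\lim_{\alpha\to1^-}\kappa_0(\alpha,t)=1$, $\kappa_1(\alpha,t)\ne0$ for $\alpha\in[0,1)$, $\kappa_0(\alpha,t)\neq0$ for $\alpha\in(0,1]$. *)

theory Defs
  imports "HOL-Analysis.Analysis"
begin

definition time_scale :: "real set \<Rightarrow> bool" where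
  "time_scale T \<longleftrightarrow> closed T \<and> T \<noteq> {}"

(* Sup and Inf on real are unspecified for unbounded sets; in the first branches below T is
   bounded on the relevant side by t, so the conventions "inf of the empty set = sup T" and
   "sup of the empty set = inf T" only use meaningful values. *)
definition fwd_jump :: "real set \<Rightarrow> real \<Rightarrow> real" where
  "fwd_jump T t = (if {s \<in> T. t < s} = {} then Sup T else Inf {s \<in> T. t < s})"

definition bwd_jump :: "real set \<Rightarrow> real \<Rightarrow> real" where
  "bwd_jump T t = (if {s \<in> T. s < t} = {} then Inf T else Sup {s \<in> T. s < t})"

definition graininess :: "real set \<Rightarrow> real \<Rightarrow> real" where
  "graininess T t = fwd_jump T t - t"

(* "t < sup T" and "t > inf T" refer to extended reals, so they are spelled out. *)
definition right_dense :: "real set \<Rightarrow> real \<Rightarrow> bool" where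
  "right_dense T t \<longleftrightarrow> (\<exists>s\<in>T. t < s) \<and> fwd_jump T t = t"

definition left_dense :: "real set \<Rightarrow> real \<Rightarrow> bool" where
  "left_dense T t \<longleftrightarrow> (\<exists>s\<in>T. s < t) \<and> bwd_jump T t = t"

definition left_scattered :: "real set \<Rightarrow> real \<Rightarrow> bool" where
  "left_scattered T t \<longleftrightarrow> bwd_jump T t < t"

definition ts_kappa :: "real set \<Rightarrow> real set" where
  "ts_kappa T = T - {m \<in> T. (\<forall>s\<in>T. s \<le> m) \<and> left_scattered T m}"

definition ts_from :: "real set \<Rightarrow> real \<Rightarrow> real set" where
  "ts_from T t0 = T \<inter> {t0..}"

definition has_delta_deriv :: "real set \<Rightarrow> (real \<Rightarrow> real) \<Rightarrow> real \<Rightarrow> real \<Rightarrow> bool" where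
  "has_delta_deriv T f D t \<longleftrightarrow>
     (\<forall>\<epsilon>>0. \<exists>\<delta>>0. \<forall>s \<in> {t - \<delta><..<t + \<delta>} \<inter> T.
        \<bar>(f (fwd_jump T t) - f s) - D * (fwd_jump T t - s)\<bar> \<le> \<epsilon> * \<bar>fwd_jump T t - s\<bar>)"

(* For t in ts_kappa T a delta derivative is automatically unique, except when T = {t}: there
   every number satisfies has_delta_deriv, so the derivative is not a well-defined number and f is
   not regarded as differentiable. *)
definition delta_differentiable :: "real set \<Rightarrow> (real \<Rightarrow> real) \<Rightarrow> real \<Rightarrow> bool" where
  "delta_differentiable T f t \<longleftrightarrow> (\<exists>!D. has_delta_deriv T f D t)"

definition delta_deriv :: "real set \<Rightarrow> (real \<Rightarrow> real) \<Rightarrow> real \<Rightarrow> real" where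
  "delta_deriv T f t = (THE D. has_delta_deriv T f D t)"

definition rd_continuous :: "real set \<Rightarrow> (real \<Rightarrow> real) \<Rightarrow> bool" where
  "rd_continuous T f \<longleftrightarrow>
     (\<forall>t\<in>T. right_dense T t \<longrightarrow> continuous (at t within T) f) \<and>
     (\<forall>t\<in>T. left_dense T t \<longrightarrow> (\<exists>l. (f \<longlongrightarrow> l) (at t within (T \<inter> {..<t}))))"

definition rd_continuous_kernel :: "real set \<Rightarrow> (real \<Rightarrow> real \<Rightarrow> real) \<Rightarrow> bool" where
  "rd_continuous_kernel T k \<longleftrightarrow>
     (\<forall>\<alpha>\<in>{0..1}. \<forall>t\<in>T. 0 \<le> k \<alpha> t) \<and>
     (\<forall>\<alpha>\<in>{0..1}. rd_continuous T (k \<alpha>)) \<and>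
     (\<forall>t\<in>T. continuous_on {0..1} (\<lambda>\<alpha>. k \<alpha> t))"

definition admissible_pair ::
  "real set \<Rightarrow> (real \<Rightarrow> real \<Rightarrow> real) \<Rightarrow> (real \<Rightarrow> real \<Rightarrow> real) \<Rightarrow> bool" where
  "admissible_pair T \<kappa>\<^sub>0 \<kappa>\<^sub>1 \<longleftrightarrow>
     rd_continuous_kernel T \<kappa>\<^sub>0 \<and> rd_continuous_kernel T \<kappa>\<^sub>1 \<and>
     (\<forall>t\<in>T.
        ((\<lambda>\<alpha>. \<kappa>\<^sub>1 \<alpha> t) \<longlongrightarrow> 1) (at_right 0) \<and>
        ((\<lambda>\<alpha>. \<kappa>\<^sub>0 \<alpha> t) \<longlongrightarrow> 0) (at_right 0) \<and>
        ((\<lambda>\<alpha>. \<kappa>\<^sub>1 \<alpha> t) \<longlongrightarrow> 0) (at_left 1) \<and>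
        ((\<lambda>\<alpha>. \<kappa>\<^sub>0 \<alpha> t) \<longlongrightarrow> 1) (at_left 1) \<and>
        (\<forall>\<alpha>\<in>{0..<1}. \<kappa>\<^sub>1 \<alpha> t \<noteq> 0) \<and>
        (\<forall>\<alpha>\<in>{0<..1}. \<kappa>\<^sub>0 \<alpha> t \<noteq> 0))"

definition conf_deriv ::
  "real set \<Rightarrow> (real \<Rightarrow> real \<Rightarrow> real) \<Rightarrow> (real \<Rightarrow> real \<Rightarrow> real) \<Rightarrow> real \<Rightarrow> (real \<Rightarrow> real) \<Rightarrow> real \<Rightarrow> real"
  where
  "conf_deriv T \<kappa>\<^sub>0 \<kappa>\<^sub>1 \<alpha> f t = \<kappa>\<^sub>1 \<alpha> t * f t + \<kappa>\<^sub>0 \<alpha> t * delta_deriv T f t"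

(* Solutions are functions on the time scale ts_from T t0, and derivatives are taken there.  The
   first derivative lives on ts_from (ts_kappa T) t0 only, so it is differentiated with respect to
   that time scale, at the points of ts_from (ts_kappa (ts_kappa T)) t0. *)
definition C2_rd :: "real set \<Rightarrow> real \<Rightarrow> (real \<Rightarrow> real) \<Rightarrow> bool" where
  "C2_rd T t0 y \<longleftrightarrow>
     (\<forall>t \<in> ts_from (ts_kappa T) t0. delta_differentiable (ts_from T t0) y t) \<and>
     (\<forall>t \<in> ts_from (ts_kappa (ts_kappa T)) t0.
        delta_differentiable (ts_from (ts_kappa T) t0) (delta_deriv (ts_from T t0) y) t) \<and>
     rd_continuous (ts_from (ts_kappa (ts_kappa T)) t0)
       (delta_deriv (ts_from (ts_kappa T) t0) (delta_deriv (ts_from T t0) y))"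

definition conf_L ::
  "real set \<Rightarrow> real \<Rightarrow> (real \<Rightarrow> real \<Rightarrow> real) \<Rightarrow> (real \<Rightarrow> real \<Rightarrow> real) \<Rightarrow> real \<Rightarrow> real \<Rightarrow> real \<Rightarrow>
   (real \<Rightarrow> real) \<Rightarrow> real \<Rightarrow> real" where
  "conf_L T t0 \<kappa>\<^sub>0 \<kappa>\<^sub>1 \<alpha> a b y t =
     conf_deriv (ts_from (ts_kappa T) t0) \<kappa>\<^sub>0 \<kappa>\<^sub>1 \<alpha>
       (conf_deriv (ts_from T t0) \<kappa>\<^sub>0 \<kappa>\<^sub>1 \<alpha> y) t
     + a * conf_deriv (ts_from T t0) \<kappa>\<^sub>0 \<kappa>\<^sub>1 \<alpha> y t
     + b * y t"

(* The middle conjunct says that the iterated derivative inside conf_L exists.  It is not always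
   implied by C2_rd: at a left-dense maximum m of ts_kappa T that is right-scattered in T,
   differentiability of the kernels with respect to T is only continuity at m. *)
definition conf_solution ::
  "real set \<Rightarrow> real \<Rightarrow> (real \<Rightarrow> real \<Rightarrow> real) \<Rightarrow> (real \<Rightarrow> real \<Rightarrow> real) \<Rightarrow> real \<Rightarrow> real \<Rightarrow> real \<Rightarrow>
   (real \<Rightarrow> real) \<Rightarrow> bool" where
  "conf_solution T t0 \<kappa>\<^sub>0 \<kappa>\<^sub>1 \<alpha> a b y \<longleftrightarrow>
     C2_rd T t0 y \<and>
     (\<forall>t \<in> ts_from (ts_kappa (ts_kappa T)) t0.
        delta_differentiable (ts_from (ts_kappa T) t0)
          (conf_deriv (ts_from T t0) \<kappa>\<^sub>0 \<kappa>\<^sub>1 \<alpha> y) t) \<and>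
     (\<forall>t \<in> ts_from (ts_kappa (ts_kappa T)) t0. conf_L T t0 \<kappa>\<^sub>0 \<kappa>\<^sub>1 \<alpha> a b y t = 0)"

definition conf_ivp_solution ::
  "real set \<Rightarrow> real \<Rightarrow> (real \<Rightarrow> real \<Rightarrow> real) \<Rightarrow> (real \<Rightarrow> real \<Rightarrow> real) \<Rightarrow> real \<Rightarrow> real \<Rightarrow> real \<Rightarrow>
   real \<Rightarrow> real \<Rightarrow> (real \<Rightarrow> real) \<Rightarrow> bool" where
  "conf_ivp_solution T t0 \<kappa>\<^sub>0 \<kappa>\<^sub>1 \<alpha> a b y0 y0\<alpha> y \<longleftrightarrow>
     conf_solution T t0 \<kappa>\<^sub>0 \<kappa>\<^sub>1 \<alpha> a b y \<and>
     y t0 = y0 \<and> conf_deriv (ts_from T t0) \<kappa>\<^sub>0 \<kappa>\<^sub>1 \<alpha> y t0 = y0\<alpha>"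

end

theory Submission
  imports Defs
begin

text \<open>
  The equation \<open>L y = 0\<close> is linear, and with \<open>u = y\<close>, \<open>v = \<Delta>\<^sup>\<alpha> y\<close> it is the first-order system
  \<open>u\<^sup>\<Delta> = (v - \<kappa>\<^sub>1 u) / \<kappa>\<^sub>0\<close>, \<open>v\<^sup>\<Delta> = - (b u + (a + \<kappa>\<^sub>1) v) / \<kappa>\<^sub>0\<close>.

  Existence: the Wronskian-type expression of the two given solutions does not vanish at \<open>t0\<close>, so
  Cramer's rule gives a linear combination of them with the prescribed data, and linear combinations
  of solutions are solutions (\<open>conf_solution_lincomb\<close>).  The Wronskian says nothing about
  \<open>t0\<close> if \<open>t0\<close> is the left-scattered maximum of \<open>ts_kappa T\<close>; then there is no point at which the
  equation has to hold, and an affine function whose slope is determined by the data is a solution;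
  its derivative at \<open>t0\<close> is unique because that of a given solution is
  (\<open>delta_differentiable_transfer\<close>).

  Uniqueness: the difference of two solutions solves the equation with zero data.  The coefficients
  of the system are continuous, so \<open>w = \<bar>u\<bar> + \<bar>v\<bar>\<close> grows at a rate of at most \<open>k w\<close> with \<open>k\<close> bounded on
  bounded sets.  A comparison of \<open>w\<close> with \<open>\<epsilon> exp (C (t - t0))\<close> along the time scale (\<open>gronwall_zero\<close>)
  gives \<open>w = 0\<close> on the domain of \<open>v\<close>, which omits a left-scattered maximum of \<open>T\<close>.  At that point
  \<open>u\<close> is recovered from its value and its derivative at the preceding point.
\<close>

section \<open>Delta derivatives\<close>

lemma fwd_jump_in:
  assumes "closed S" "t \<in> S"
  shows "fwd_jump S t \<in> S"
proof (cases "{s \<in> S. t < s} = {}")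
  case True
  then have "Sup S = t"
    using assms(2) by (intro cSup_eq_maximum) (auto simp: not_less)
  then show ?thesis using True assms(2) by (simp add: fwd_jump_def)
next
  case False
  have "bdd_below {s \<in> S. t < s}" by (rule bdd_belowI[of _ t]) auto
  then have "Inf {s \<in> S. t < s} \<in> closure {s \<in> S. t < s}"
    using False by (rule closure_contains_Inf[rotated])
  moreover have "closure {s \<in> S. t < s} \<subseteq> S"
    using assms(1) by (intro closure_minimal) auto
  ultimately show ?thesis using False by (auto simp: fwd_jump_def)
qed

lemma fwd_jump_eq_Inf: "s \<in> S \<Longrightarrow> t < s \<Longrightarrow> fwd_jump S t = Inf {r \<in> S. t < r}"
  unfolding fwd_jump_def by (subst if_not_P) auto

lemma fwd_jump_bounds:
  assumes "s \<in> S" "t < s"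
  shows "t \<le> fwd_jump S t" "fwd_jump S t \<le> s"
proof -
  have ne: "{r \<in> S. t < r} \<noteq> {}" using assms by auto
  have "fwd_jump S t = Inf {r \<in> S. t < r}" using assms by (rule fwd_jump_eq_Inf)
  moreover have "t \<le> Inf {r \<in> S. t < r}" using ne by (intro cInf_greatest) auto
  moreover have "Inf {r \<in> S. t < r} \<le> s"
    using assms by (intro cInf_lower bdd_belowI[of _ t]) auto
  ultimately show "t \<le> fwd_jump S t" "fwd_jump S t \<le> s" by auto
qed

lemma fwd_jump_eqI:
  assumes "m \<in> S" "t < m" "\<And>s. s \<in> S \<Longrightarrow> t < s \<Longrightarrow> m \<le> s"
  shows "fwd_jump S t = m"
proof -
  have "Inf {r \<in> S. t < r} = m" using assms by (intro cInf_eq_minimum) auto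
  then show ?thesis using fwd_jump_eq_Inf[OF assms(1,2)] by simp
qed

lemma has_delta_deriv_cong:
  assumes "closed S" "t \<in> S" "\<And>s. s \<in> S \<Longrightarrow> f s = g s"
  shows "has_delta_deriv S f D t \<longleftrightarrow> has_delta_deriv S g D t"
  using assms(3) fwd_jump_in[OF assms(1,2)] by (simp add: has_delta_deriv_def)

lemma has_delta_deriv_lincomb:
  fixes c d :: real
  assumes "has_delta_deriv S f D t" "has_delta_deriv S g E t"
  shows "has_delta_deriv S (\<lambda>s. c * f s + d * g s) (c * D + d * E) t"
  unfolding has_delta_deriv_def
proof (intro allI impI)
  fix \<epsilon> :: real assume "\<epsilon> > 0"
  define M where "M = \<bar>c\<bar> + \<bar>d\<bar> + 1"
  have M: "M > 0" "\<bar>c\<bar> + \<bar>d\<bar> \<le> M" unfolding M_def by linarith+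
  define e where "e = \<epsilon> / M"
  have e: "e > 0" "(\<bar>c\<bar> + \<bar>d\<bar>) * e \<le> \<epsilon>"
    using \<open>\<epsilon> > 0\<close> M mult_right_mono[of "\<bar>c\<bar> + \<bar>d\<bar>" M e] by (auto simp: e_def)
  let ?j = "fwd_jump S t"
  obtain \<delta>1 where 1: "\<delta>1 > 0"
    "\<And>s. s \<in> {t - \<delta>1<..<t + \<delta>1} \<inter> S \<Longrightarrow> \<bar>(f ?j - f s) - D * (?j - s)\<bar> \<le> e * \<bar>?j - s\<bar>"
    using assms(1) e(1) unfolding has_delta_deriv_def by meson
  obtain \<delta>2 where 2: "\<delta>2 > 0"
    "\<And>s. s \<in> {t - \<delta>2<..<t + \<delta>2} \<inter> S \<Longrightarrow> \<bar>(g ?j - g s) - E * (?j - s)\<bar> \<le> e * \<bar>?j - s\<bar>"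
    using assms(2) e(1) unfolding has_delta_deriv_def by meson
  show "\<exists>\<delta>>0. \<forall>s\<in>{t - \<delta><..<t + \<delta>} \<inter> S.
          \<bar>((c * f ?j + d * g ?j) - (c * f s + d * g s)) - (c * D + d * E) * (?j - s)\<bar>
            \<le> \<epsilon> * \<bar>?j - s\<bar>"
  proof (intro exI[of _ "min \<delta>1 \<delta>2"] conjI ballI)
    fix s assume s: "s \<in> {t - min \<delta>1 \<delta>2<..<t + min \<delta>1 \<delta>2} \<inter> S"
    let ?F = "(f ?j - f s) - D * (?j - s)" and ?G = "(g ?j - g s) - E * (?j - s)"
    have F: "\<bar>?F\<bar> \<le> e * \<bar>?j - s\<bar>" using s by (intro 1) auto
    have G: "\<bar>?G\<bar> \<le> e * \<bar>?j - s\<bar>" using s by (intro 2) auto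
    have "((c * f ?j + d * g ?j) - (c * f s + d * g s)) - (c * D + d * E) * (?j - s)
            = c * ?F + d * ?G" by (simp add: algebra_simps)
    also have "\<bar>\<dots>\<bar> \<le> \<bar>c\<bar> * \<bar>?F\<bar> + \<bar>d\<bar> * \<bar>?G\<bar>"
      by (metis abs_mult abs_triangle_ineq)
    also have "\<dots> \<le> \<bar>c\<bar> * (e * \<bar>?j - s\<bar>) + \<bar>d\<bar> * (e * \<bar>?j - s\<bar>)"
      using F G by (intro add_mono mult_left_mono) auto
    also have "\<dots> = ((\<bar>c\<bar> + \<bar>d\<bar>) * e) * \<bar>?j - s\<bar>" by (simp add: algebra_simps)
    also have "\<dots> \<le> \<epsilon> * \<bar>?j - s\<bar>" using e(2) by (intro mult_right_mono) auto
    finally show "\<bar>((c * f ?j + d * g ?j) - (c * f s + d * g s)) - (c * D + d * E) * (?j - s)\<bar>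
            \<le> \<epsilon> * \<bar>?j - s\<bar>" .
  qed (use 1 2 in auto)
qed

lemma has_delta_deriv_delta_deriv:
  assumes "delta_differentiable S f t"
  shows "has_delta_deriv S f (delta_deriv S f t) t"
  using assms unfolding delta_differentiable_def delta_deriv_def by (rule theI')

text \<open>
  Whether a delta derivative is unique depends on the time scale and the point but not on the
  function: two derivatives \<open>D \<noteq> D'\<close> of \<open>g\<close> would make \<open>D - D'\<close> a derivative of the zero function,
  which could then be added to the derivative of \<open>f\<close>.
\<close>
lemma delta_differentiable_transfer:
  assumes "delta_differentiable S f t" "has_delta_deriv S g D t"
  shows "delta_differentiable S g t" "delta_deriv S g t = D"
proof -
  have uniq: "D' = D" if "has_delta_deriv S g D' t" for D'
  proof -
    let ?E = "delta_deriv S f t"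
    have f: "has_delta_deriv S f ?E t" using assms(1) by (rule has_delta_deriv_delta_deriv)
    have "has_delta_deriv S (\<lambda>s. 0) (D' - D) t"
      using has_delta_deriv_lincomb[OF that assms(2), of 1 "-1"] by simp
    from has_delta_deriv_lincomb[OF f this, of 1 1]
    have "has_delta_deriv S f (?E + (D' - D)) t" by simp
    with f assms(1) show ?thesis unfolding delta_differentiable_def
      by (metis add_cancel_right_right eq_iff_diff_eq_0)
  qed
  then show "delta_differentiable S g t"
    using assms(2) unfolding delta_differentiable_def by blast
  show "delta_deriv S g t = D"
    unfolding delta_deriv_def using assms(2) uniq by (rule the_equality)
qed

lemma delta_deriv_lincomb:
  assumes "delta_differentiable S f t" "delta_differentiable S g t"
    and "closed S" "t \<in> S" "\<And>s. s \<in> S \<Longrightarrow> h s = c * f s + d * g s"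
  shows "delta_differentiable S h t"
    and "delta_deriv S h t = c * delta_deriv S f t + d * delta_deriv S g t"
proof -
  have "has_delta_deriv S h (c * delta_deriv S f t + d * delta_deriv S g t) t"
    using has_delta_deriv_lincomb[OF assms(1,2)[THEN has_delta_deriv_delta_deriv]]
      has_delta_deriv_cong[OF assms(3-5)] by simp
  from delta_differentiable_transfer[OF assms(1) this]
  show "delta_differentiable S h t"
    and "delta_deriv S h t = c * delta_deriv S f t + d * delta_deriv S g t" .
qed

lemma has_delta_deriv_affine: "has_delta_deriv S (\<lambda>s. c + D * (s - t0)) D t"
  unfolding has_delta_deriv_def by (auto simp: algebra_simps intro: exI[of _ 1])

lemma has_delta_deriv_subset:
  assumes "has_delta_deriv S f D t" "R \<subseteq> S" "fwd_jump R t = fwd_jump S t"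
  shows "has_delta_deriv R f D t"
  unfolding has_delta_deriv_def
proof (intro allI impI)
  fix \<epsilon> :: real assume "\<epsilon> > 0"
  then obtain \<delta> where "\<delta> > 0" "\<forall>s \<in> {t - \<delta><..<t + \<delta>} \<inter> S.
      \<bar>(f (fwd_jump S t) - f s) - D * (fwd_jump S t - s)\<bar> \<le> \<epsilon> * \<bar>fwd_jump S t - s\<bar>"
    using assms(1) unfolding has_delta_deriv_def by meson
  then show "\<exists>\<delta>>0. \<forall>s\<in>{t - \<delta><..<t + \<delta>} \<inter> R.
      \<bar>(f (fwd_jump R t) - f s) - D * (fwd_jump R t - s)\<bar> \<le> \<epsilon> * \<bar>fwd_jump R t - s\<bar>"
    using assms(2,3) by (intro exI[of _ \<delta>]) auto
qed

text \<open>
  The defining estimate may be used at \<open>s = t\<close> as well as at nearby points; subtracting the two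
  instances eliminates the value at the forward jump.
\<close>
lemma has_delta_deriv_imp_continuous:
  assumes "has_delta_deriv S f D t" "t \<in> S"
  shows "continuous (at t within S) f"
  unfolding continuous_within_eps_delta dist_real_def
proof (intro allI impI)
  fix \<epsilon> :: real assume "\<epsilon> > 0"
  let ?j = "fwd_jump S t"
  define M where "M = 2 * \<bar>?j - t\<bar> + 1"
  have M: "M > 0" unfolding M_def by (intro add_nonneg_pos) auto
  define e where "e = \<epsilon> / (2 * M)"
  have e: "e > 0" "e * M = \<epsilon> / 2" using \<open>\<epsilon> > 0\<close> M by (auto simp: e_def)
  obtain \<delta> where \<delta>: "\<delta> > 0"
    "\<And>s. s \<in> {t - \<delta><..<t + \<delta>} \<inter> S \<Longrightarrow> \<bar>(f ?j - f s) - D * (?j - s)\<bar> \<le> e * \<bar>?j - s\<bar>"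
    using assms(1) e(1) unfolding has_delta_deriv_def by meson
  define d where "d = min (min \<delta> 1) (\<epsilon> / (2 * (\<bar>D\<bar> + 1)))"
  have d: "d > 0" "d \<le> \<delta>" "d \<le> 1" "d \<le> \<epsilon> / (2 * (\<bar>D\<bar> + 1))"
    using \<delta>(1) \<open>\<epsilon> > 0\<close> by (auto simp: d_def)
  show "\<exists>d>0. \<forall>s\<in>S. \<bar>s - t\<bar> < d \<longrightarrow> \<bar>f s - f t\<bar> < \<epsilon>"
  proof (intro exI[of _ d] conjI ballI impI)
    fix s assume s: "s \<in> S" "\<bar>s - t\<bar> < d"
    have 1: "\<bar>(f ?j - f s) - D * (?j - s)\<bar> \<le> e * \<bar>?j - s\<bar>" using s d by (intro \<delta>(2)) auto
    have 2: "\<bar>(f ?j - f t) - D * (?j - t)\<bar> \<le> e * \<bar>?j - t\<bar>"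
      using \<delta>(1) assms(2) by (intro \<delta>(2)) auto
    have "f s - f t = ((f ?j - f t) - D * (?j - t)) - ((f ?j - f s) - D * (?j - s)) + D * (s - t)"
      by (simp add: algebra_simps)
    then have "\<bar>f s - f t\<bar> \<le> e * \<bar>?j - t\<bar> + e * \<bar>?j - s\<bar> + \<bar>D * (s - t)\<bar>"
      using 1 2 by linarith
    also have "e * \<bar>?j - t\<bar> + e * \<bar>?j - s\<bar> = e * (\<bar>?j - t\<bar> + \<bar>?j - s\<bar>)"
      by (simp add: algebra_simps)
    also have "\<dots> \<le> e * M"
      using e(1) s(2) d(3) by (intro mult_left_mono) (auto simp: M_def)
    also have "\<bar>D * (s - t)\<bar> < \<epsilon> / 2"
    proof -
      have "\<bar>D * (s - t)\<bar> \<le> (\<bar>D\<bar> + 1) * \<bar>s - t\<bar>"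
        by (simp add: abs_mult mult_right_mono)
      also have "\<dots> < (\<bar>D\<bar> + 1) * d" using s(2) by (intro mult_strict_left_mono) auto
      also have "\<dots> \<le> (\<bar>D\<bar> + 1) * (\<epsilon> / (2 * (\<bar>D\<bar> + 1)))" using d(4) by (intro mult_left_mono) auto
      also have "\<dots> = \<epsilon> / 2" by (simp add: field_simps)
      finally show ?thesis .
    qed
    finally show "\<bar>f s - f t\<bar> < \<epsilon>" using e(2) by linarith
  qed (rule d(1))
qed

text \<open>
  The two ways of going forward from a point that is not maximal, a jump over a gap and a limit
  from the right, obey the same first-order estimate; stating it once spares a case distinction
  in arguments by induction along the time scale.
\<close>
lemma has_delta_deriv_forward:
  assumes D: "has_delta_deriv S f D t" and t: "t \<in> S" and e: "e > 0"
    and r: "r \<in> S" "t < r"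
  shows "\<exists>\<delta>>0. \<forall>s\<in>S. t < s \<and> (s < t + \<delta> \<or> s = fwd_jump S t) \<longrightarrow>
           \<bar>f s - f t - D * (s - t)\<bar> \<le> e * (s - t)"
proof -
  let ?j = "fwd_jump S t"
  obtain \<delta> where \<delta>: "\<delta> > 0"
    "\<And>s. s \<in> {t - \<delta><..<t + \<delta>} \<inter> S \<Longrightarrow> \<bar>(f ?j - f s) - D * (?j - s)\<bar> \<le> e * \<bar>?j - s\<bar>"
    using D e unfolding has_delta_deriv_def by meson
  show ?thesis
  proof (cases "?j = t")
    case True
    have "\<bar>f s - f t - D * (s - t)\<bar> \<le> e * (s - t)" if "s \<in> S" "t < s" "s < t + \<delta>" for s
    proof -
      have "\<bar>(f t - f s) - D * (t - s)\<bar> \<le> e * \<bar>t - s\<bar>"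
        using \<delta>(2)[of s] that True by auto
      moreover have "f s - f t - D * (s - t) = - ((f t - f s) - D * (t - s))"
        by (simp add: algebra_simps)
      ultimately show ?thesis using that by simp
    qed
    then show ?thesis using \<delta>(1) True by (intro exI[of _ \<delta>]) auto
  next
    case False
    with fwd_jump_bounds(1)[OF r] have gap: "t < ?j" by simp
    have "\<bar>(f ?j - f t) - D * (?j - t)\<bar> \<le> e * \<bar>?j - t\<bar>"
      using \<delta> t by auto
    then show ?thesis
      using gap fwd_jump_bounds(2)[of _ S t] by (intro exI[of _ "?j - t"]) fastforce
  qed
qed

section \<open>Growth estimates\<close>

text \<open>
  Write \<open>g\<close> for the bounding exponential and let \<open>m\<close> be the infimum of the points up to \<open>x\<close> where
  \<open>w \<le> g\<close> fails.  If the inequality holds at \<open>m\<close> itself, the forward estimate extends it to the right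
  of \<open>m\<close>.  If it fails at \<open>m\<close>, this contradicts continuity when \<open>m\<close> is a limit from the left, and the
  forward estimate at the preceding point otherwise.  The rate \<open>K + 1\<close> of \<open>g\<close> exceeds the rate \<open>K\<close> of
  \<open>w\<close>, which leaves room for the error term \<open>e\<close>; the factor \<open>\<epsilon> > 0\<close> makes \<open>g\<close> positive, so that
  \<open>e = g t\<close> is a possible choice.
\<close>
lemma exp_comparison:
  fixes w :: "real \<Rightarrow> real"
  assumes S: "closed S" "t0 \<in> S" "\<And>s. s \<in> S \<Longrightarrow> t0 \<le> s"
    and w0: "w t0 \<le> 0" and cont: "continuous_on S w"
    and "K \<ge> 0" "\<epsilon> > 0"
    and step: "\<And>t e r. t \<in> S \<Longrightarrow> r \<in> S \<Longrightarrow> t < r \<Longrightarrow> r \<le> x \<Longrightarrow> e > 0 \<Longrightarrow>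
      \<exists>\<delta>>0. \<forall>s\<in>S. t < s \<and> (s < t + \<delta> \<or> s = fwd_jump S t) \<longrightarrow> w s \<le> w t + (K * w t + e) * (s - t)"
    and x: "x \<in> S"
  shows "w x \<le> \<epsilon> * exp ((K + 1) * (x - t0))"
proof (rule ccontr)
  define g where "g s = \<epsilon> * exp ((K + 1) * (s - t0))" for s
  assume "\<not> w x \<le> \<epsilon> * exp ((K + 1) * (x - t0))"
  then have wx: "g x < w x" by (simp add: g_def)
  have gpos: "g s > 0" for s using \<open>\<epsilon> > 0\<close> by (simp add: g_def)
  have growth: "g t * (1 + (K + 1) * (s - t)) \<le> g s" for s t
  proof -
    have "g s = g t * exp ((K + 1) * (s - t))"
      by (simp add: g_def flip: exp_add) (simp add: algebra_simps)
    then show ?thesis using gpos[of t] exp_ge_add_one_self[of "(K + 1) * (s - t)"] by simp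
  qed
  have forward: "\<exists>\<delta>>0. \<forall>s\<in>S. t < s \<and> (s < t + \<delta> \<or> s = fwd_jump S t) \<longrightarrow> w s \<le> g s"
    if t: "t \<in> S" "r \<in> S" "t < r" "r \<le> x" and wt: "w t \<le> g t" for t r
  proof -
    obtain \<delta> where \<delta>: "\<delta> > 0"
      "\<And>s. s \<in> S \<Longrightarrow> t < s \<Longrightarrow> s < t + \<delta> \<or> s = fwd_jump S t \<Longrightarrow>
             w s \<le> w t + (K * w t + g t) * (s - t)"
      using step[OF t gpos[of t]] by auto
    have "w s \<le> g s" if s: "s \<in> S" "t < s" "s < t + \<delta> \<or> s = fwd_jump S t" for s
    proof -
      have "w s \<le> w t + (K * w t + g t) * (s - t)" using s by (rule \<delta>(2))
      also have "\<dots> \<le> g t + (K * g t + g t) * (s - t)"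
        using wt s \<open>K \<ge> 0\<close> by (intro add_mono mult_right_mono mult_left_mono) auto
      also have "\<dots> = g t * (1 + (K + 1) * (s - t))" by (simp add: algebra_simps)
      also have "\<dots> \<le> g s" by (rule growth)
      finally show ?thesis .
    qed
    then show ?thesis using \<delta>(1) by auto
  qed
  define B where "B = {s \<in> S. s \<le> x \<and> g s < w s}"
  have xB: "x \<in> B" using x wx by (simp add: B_def)
  have bdd: "bdd_below B" by (rule bdd_belowI[of _ t0]) (auto simp: B_def S(3))
  define m where "m = Inf B"
  have mS: "m \<in> S"
  proof -
    have "m \<in> closure B" unfolding m_def using xB bdd by (intro closure_contains_Inf) auto
    then show ?thesis using closure_minimal[of B S] S(1) by (auto simp: B_def)
  qed
  have mx: "m \<le> x" unfolding m_def using xB bdd by (rule cInf_lower)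
  have below: "w s \<le> g s" if "s \<in> S" "s < m" for s
  proof (rule ccontr)
    assume "\<not> w s \<le> g s"
    then have "s \<in> B" using that mx by (auto simp: B_def)
    then show False using cInf_lower[OF _ bdd] that(2) by (force simp: m_def)
  qed
  show False
  proof (cases "w m \<le> g m")
    case True
    have "m < x" using mx wx True by (cases "m = x") auto
    from forward[OF mS x this order_refl True]
    obtain \<delta> where \<delta>: "\<delta> > 0" "\<And>s. s \<in> S \<Longrightarrow> m < s \<Longrightarrow> s < m + \<delta> \<Longrightarrow> w s \<le> g s" by auto
    obtain s where s: "s \<in> B" "s < m + \<delta>"
      using cInf_lessD[of B "m + \<delta>"] xB \<delta>(1) by (auto simp: m_def)
    moreover have "m \<le> s" using s(1) bdd by (simp add: m_def cInf_lower)
    moreover have "m \<noteq> s" using s(1) True by (auto simp: B_def)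
    ultimately show False using \<delta>(2)[of s] by (auto simp: B_def)
  next
    case False
    have "m \<noteq> t0" using False w0 gpos[of t0] by auto
    then have "t0 < m" using S(3)[OF mS] by simp
    define P where "P = {s \<in> S. s < m}"
    have P: "P \<noteq> {}" "bdd_above P" using \<open>t0 < m\<close> S(2) by (auto simp: P_def intro!: bdd_aboveI[of _ m])
    have cl: "Sup P \<in> closure P" using P by (rule closure_contains_Sup)
    have pm: "Sup P \<le> m" using P(1) by (intro cSup_least) (auto simp: P_def)
    show False
    proof (cases "Sup P = m")
      case True
      have "continuous_on S g" unfolding g_def by (intro continuous_intros)
      then have "closed {s \<in> S. w s \<le> g s}"
        using cont S(1) by (intro continuous_on_closed_Collect_le)
      then have "closure P \<subseteq> {s \<in> S. w s \<le> g s}"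
        using below by (intro closure_minimal) (auto simp: P_def)
      then show False using cl True False by auto
    next
      case gap: False
      have pS: "Sup P \<in> S" using cl closure_minimal[of P S] S(1) by (auto simp: P_def)
      have pm': "Sup P < m" using gap pm by simp
      have "fwd_jump S (Sup P) = m"
      proof (rule fwd_jump_eqI[OF mS pm'])
        show "m \<le> s" if "s \<in> S" "Sup P < s" for s
          using cSup_upper[OF _ P(2), of s] that by (force simp: P_def)
      qed
      then show False
        using forward[OF pS mS pm' mx below[OF pS pm']] mS pm' False by auto
    qed
  qed
qed

text \<open>
  A form of Gronwall's inequality for homogeneous linear systems: \<open>\<bar>u\<bar> + \<bar>v\<bar>\<close> satisfies the growth
  condition of \<open>exp_comparison\<close> with \<open>K\<close> a bound of \<open>k\<close> on the compact part of \<open>S\<close> up to \<open>x\<close>, so it is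
  below every positive multiple of one exponential.  Derivatives are assumed only at points that are
  not maximal in \<open>S\<close>, because at a maximum of \<open>ts_kappa T\<close> the derivative of a solution refers to
  the larger time scale \<open>T\<close> and need not agree with the one on \<open>ts_kappa T\<close>.
\<close>
lemma gronwall_zero:
  fixes u v :: "real \<Rightarrow> real"
  assumes S: "closed S" "t0 \<in> S" "\<And>s. s \<in> S \<Longrightarrow> t0 \<le> s"
    and zero: "u t0 = 0" "v t0 = 0"
    and cont: "continuous_on S u" "continuous_on S v" "continuous_on S k"
    and du: "\<And>t r. t \<in> S \<Longrightarrow> r \<in> S \<Longrightarrow> t < r \<Longrightarrow> has_delta_deriv S u (du t) t"
    and dv: "\<And>t r. t \<in> S \<Longrightarrow> r \<in> S \<Longrightarrow> t < r \<Longrightarrow> has_delta_deriv S v (dv t) t"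
    and bound: "\<And>t r. t \<in> S \<Longrightarrow> r \<in> S \<Longrightarrow> t < r \<Longrightarrow> \<bar>du t\<bar> + \<bar>dv t\<bar> \<le> k t * (\<bar>u t\<bar> + \<bar>v t\<bar>)"
    and x: "x \<in> S"
  shows "u x = 0" "v x = 0"
proof -
  define w where "w s = \<bar>u s\<bar> + \<bar>v s\<bar>" for s
  have "compact (S \<inter> {t0..x})" using S(1) by (simp add: closed_Int_compact)
  then have "bounded (k ` (S \<inter> {t0..x}))"
    using cont(3) by (intro compact_imp_bounded compact_continuous_image) (auto elim: continuous_on_subset)
  then obtain K where K: "\<And>s. s \<in> S \<Longrightarrow> s \<le> x \<Longrightarrow> \<bar>k s\<bar> \<le> K"
    using S(3) by (force simp: bounded_iff)
  have "K \<ge> 0" using K[OF x] by force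
  have step: "\<exists>\<delta>>0. \<forall>s\<in>S. t < s \<and> (s < t + \<delta> \<or> s = fwd_jump S t) \<longrightarrow>
      w s \<le> w t + (K * w t + e) * (s - t)"
    if t: "t \<in> S" "r \<in> S" "t < r" "r \<le> x" and e: "e > 0" for t r e
  proof -
    have e2: "e / 2 > 0" using e by simp
    obtain \<delta>1 where 1: "\<delta>1 > 0" "\<And>s. s \<in> S \<Longrightarrow> t < s \<Longrightarrow> s < t + \<delta>1 \<or> s = fwd_jump S t \<Longrightarrow>
        \<bar>u s - u t - du t * (s - t)\<bar> \<le> e / 2 * (s - t)"
      using has_delta_deriv_forward[OF du[OF t(1-3)] t(1) e2 t(2,3)] by auto
    obtain \<delta>2 where 2: "\<delta>2 > 0" "\<And>s. s \<in> S \<Longrightarrow> t < s \<Longrightarrow> s < t + \<delta>2 \<or> s = fwd_jump S t \<Longrightarrow>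
        \<bar>v s - v t - dv t * (s - t)\<bar> \<le> e / 2 * (s - t)"
      using has_delta_deriv_forward[OF dv[OF t(1-3)] t(1) e2 t(2,3)] by auto
    have rate: "\<bar>du t\<bar> + \<bar>dv t\<bar> \<le> K * w t"
    proof -
      have "k t * w t \<le> K * w t" using K[of t] t by (intro mult_right_mono) (auto simp: w_def)
      then show ?thesis using bound[OF t(1-3)] by (simp add: w_def)
    qed
    have "w s \<le> w t + (K * w t + e) * (s - t)"
      if s: "s \<in> S" "t < s" "s < t + min \<delta>1 \<delta>2 \<or> s = fwd_jump S t" for s
    proof -
      have triangle: "\<bar>x\<bar> \<le> \<bar>y\<bar> + \<bar>r\<bar> + z" if "\<bar>x - y - r\<bar> \<le> z" for x y r z :: real
        using that by linarith
      have "\<bar>u s\<bar> \<le> \<bar>u t\<bar> + \<bar>du t * (s - t)\<bar> + e / 2 * (s - t)"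
        using s by (intro triangle 1) auto
      moreover have "\<bar>v s\<bar> \<le> \<bar>v t\<bar> + \<bar>dv t * (s - t)\<bar> + e / 2 * (s - t)"
        using s by (intro triangle 2) auto
      moreover have "\<bar>du t * (s - t)\<bar> = \<bar>du t\<bar> * (s - t)" "\<bar>dv t * (s - t)\<bar> = \<bar>dv t\<bar> * (s - t)"
        using s by (simp_all add: abs_mult)
      ultimately have "w s \<le> w t + (\<bar>du t\<bar> * (s - t) + \<bar>dv t\<bar> * (s - t)) + e * (s - t)"
        unfolding w_def by simp
      also have "\<bar>du t\<bar> * (s - t) + \<bar>dv t\<bar> * (s - t) = (\<bar>du t\<bar> + \<bar>dv t\<bar>) * (s - t)"
        by (simp add: algebra_simps)
      also have "\<dots> \<le> (K * w t) * (s - t)" using rate s by (intro mult_right_mono) auto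
      finally show ?thesis by (simp add: algebra_simps)
    qed
    then show ?thesis using 1(1) 2(1) by (intro exI[of _ "min \<delta>1 \<delta>2"]) auto
  qed
  have w0: "w t0 \<le> 0" by (simp add: w_def zero)
  have cw: "continuous_on S w" unfolding w_def using cont by (intro continuous_intros)
  have "w x \<le> 0 + \<epsilon>" if "\<epsilon> > 0" for \<epsilon>
  proof -
    define c where "c = exp ((K + 1) * (x - t0))"
    have "c > 0" by (simp add: c_def)
    then have "w x \<le> \<epsilon> / c * c"
      unfolding c_def using that
      by (intro exp_comparison[OF S w0 cw \<open>K \<ge> 0\<close> _ step x]) auto
    then show ?thesis using \<open>c > 0\<close> by simp
  qed
  then have "w x \<le> 0" by (rule field_le_epsilon)
  then show "u x = 0" "v x = 0" by (auto simp: w_def)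
qed

section \<open>Removing a left-scattered maximum\<close>

lemma ts_kappa_subset: "ts_kappa T \<subseteq> T"
  by (auto simp: ts_kappa_def)

lemma not_max_in_ts_kappa:
  assumes "t \<in> T" "s \<in> T" "t < s"
  shows "t \<in> ts_kappa T"
  using assms by (force simp: ts_kappa_def)

lemma removed_point:
  assumes "m \<in> T" "m \<notin> ts_kappa T"
  shows "\<And>s. s \<in> T \<Longrightarrow> s \<le> m" "bwd_jump T m < m" "ts_kappa T = T - {m}"
proof -
  show max: "\<And>s. s \<in> T \<Longrightarrow> s \<le> m" and gap: "bwd_jump T m < m"
    using assms by (auto simp: ts_kappa_def left_scattered_def)
  show "ts_kappa T = T - {m}"
    using assms max gap by (auto simp: ts_kappa_def left_scattered_def intro: antisym)
qed

lemma le_bwd_jump: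
  assumes "s \<in> T" "s < t"
  shows "s \<le> bwd_jump T t"
proof -
  have "s \<le> Sup {r \<in> T. r < t}"
    using assms by (intro cSup_upper bdd_aboveI[of _ t]) auto
  then show ?thesis using assms by (auto simp: bwd_jump_def)
qed

lemma bwd_jump_in:
  assumes "closed T" "s \<in> T" "s < t"
  shows "bwd_jump T t \<in> T"
proof -
  have "bdd_above {r \<in> T. r < t}" by (rule bdd_aboveI[of _ t]) auto
  then have "Sup {r \<in> T. r < t} \<in> closure {r \<in> T. r < t}"
    using assms by (intro closure_contains_Sup) auto
  moreover have "closure {r \<in> T. r < t} \<subseteq> T"
    using assms(1) by (intro closure_minimal) auto
  ultimately show ?thesis using assms(2,3) by (auto simp: bwd_jump_def)
qed

lemma closed_ts_kappa:
  assumes "closed T"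
  shows "closed (ts_kappa T)"
proof (cases "ts_kappa T = T")
  case False
  then obtain m where m: "m \<in> T" "m \<notin> ts_kappa T" using ts_kappa_subset by blast
  note r = removed_point[OF m]
  have "ts_kappa T = T \<inter> {..bwd_jump T m}"
    using r le_bwd_jump[of _ T m] by (force simp: less_le)
  then show ?thesis using assms by (simp add: closed_Int)
qed (use assms in simp)

lemma closed_ts_from: "closed T \<Longrightarrow> closed (ts_from T t0)"
  by (simp add: ts_from_def closed_Int)

lemma ts_from_mono: "A \<subseteq> B \<Longrightarrow> ts_from A t0 \<subseteq> ts_from B t0"
  by (auto simp: ts_from_def)

text \<open>
  Only a maximum can be removed, and it is not the forward jump of a point with another point of
  \<open>ts_kappa T\<close> above it.
\<close>
lemma fwd_jump_ts_from_ts_kappa: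
  assumes "r \<in> ts_from (ts_kappa T) t0" "t < r"
  shows "fwd_jump (ts_from (ts_kappa T) t0) t = fwd_jump (ts_from T t0) t"
proof (cases "ts_kappa T = T")
  case False
  then obtain m where m: "m \<in> T" "m \<notin> ts_kappa T" using ts_kappa_subset by blast
  note rem = removed_point[OF m]
  let ?A = "{s \<in> ts_from (ts_kappa T) t0. t < s}"
  have rm: "r < m" using assms rem by (auto simp: ts_from_def less_le)
  then have "t < m" "t0 \<le> m" using assms by (auto simp: ts_from_def)
  then have B: "{s \<in> ts_from T t0. t < s} = insert m ?A"
    unfolding ts_from_def rem(3) using m(1) by blast
  have bdd: "bdd_below ?A" by (rule bdd_belowI[of _ t]) auto
  have ne: "?A \<noteq> {}" using assms by auto
  have "Inf ?A \<le> r" using assms bdd by (intro cInf_lower) auto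
  then have "Inf (insert m ?A) = Inf ?A"
    using cInf_insert[OF ne bdd] rm by (simp add: inf_min)
  then show ?thesis
    using fwd_jump_eq_Inf[OF assms] fwd_jump_eq_Inf[of r "ts_from T t0" t] assms B
      ts_from_mono[OF ts_kappa_subset, of T t0] by auto
qed simp

section \<open>Linearity of the equation\<close>

lemma rd_continuous_lincomb:
  assumes f: "rd_continuous S f" and g: "rd_continuous S g"
    and h: "\<And>s. s \<in> S \<Longrightarrow> h s = c * f s + d * g s"
  shows "rd_continuous S h"
  unfolding rd_continuous_def
proof (intro conjI ballI impI)
  fix t assume t: "t \<in> S" "right_dense S t"
  then have "continuous (at t within S) (\<lambda>s. c * f s + d * g s)"
    using f g by (intro continuous_intros) (auto simp: rd_continuous_def)
  then have "((\<lambda>s. c * f s + d * g s) \<longlongrightarrow> h t) (at t within S)"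
    using h t by (simp add: continuous_within)
  then have "(h \<longlongrightarrow> h t) (at t within S)"
    by (rule Lim_transform_within[where d = 1]) (auto simp: h)
  then show "continuous (at t within S) h" by (simp add: continuous_within)
next
  fix t assume t: "t \<in> S" "left_dense S t"
  then obtain k l where "(f \<longlongrightarrow> k) (at t within (S \<inter> {..<t}))" "(g \<longlongrightarrow> l) (at t within (S \<inter> {..<t}))"
    using f g unfolding rd_continuous_def by blast
  then have "((\<lambda>s. c * f s + d * g s) \<longlongrightarrow> c * k + d * l) (at t within (S \<inter> {..<t}))"
    by (intro tendsto_intros)
  then have "(h \<longlongrightarrow> c * k + d * l) (at t within (S \<inter> {..<t}))"
    by (rule Lim_transform_within[where d = 1]) (auto simp: h)
  then show "\<exists>l. (h \<longlongrightarrow> l) (at t within (S \<inter> {..<t}))" by blast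
qed

lemma conf_deriv_lincomb:
  assumes "closed S" "t \<in> S" "delta_differentiable S f t" "delta_differentiable S g t"
    and "\<And>s. s \<in> S \<Longrightarrow> h s = c * f s + d * g s"
  shows "conf_deriv S \<kappa>\<^sub>0 \<kappa>\<^sub>1 \<alpha> h t = c * conf_deriv S \<kappa>\<^sub>0 \<kappa>\<^sub>1 \<alpha> f t + d * conf_deriv S \<kappa>\<^sub>0 \<kappa>\<^sub>1 \<alpha> g t"
  using delta_deriv_lincomb(2)[OF assms(3,4,1,2,5)] assms(2,5)
  by (simp add: conf_deriv_def algebra_simps)

text \<open>
  The derivative on the smaller time scale sees only values at its own points, where the inner
  derivative is linear; hence linearity passes to the iterated derivatives.  The second conclusion
  serves to compute the initial data of a combination.
\<close>
lemma conf_solution_lincomb: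
  fixes c d :: real
  assumes T: "closed T"
    and y: "conf_solution T t0 \<kappa>\<^sub>0 \<kappa>\<^sub>1 \<alpha> a b y" and z: "conf_solution T t0 \<kappa>\<^sub>0 \<kappa>\<^sub>1 \<alpha> a b z"
  defines "h \<equiv> \<lambda>s. c * y s + d * z s"
  shows "conf_solution T t0 \<kappa>\<^sub>0 \<kappa>\<^sub>1 \<alpha> a b h"
    and "\<And>t. t \<in> ts_from (ts_kappa T) t0 \<Longrightarrow>
      conf_deriv (ts_from T t0) \<kappa>\<^sub>0 \<kappa>\<^sub>1 \<alpha> h t
        = c * conf_deriv (ts_from T t0) \<kappa>\<^sub>0 \<kappa>\<^sub>1 \<alpha> y t + d * conf_deriv (ts_from T t0) \<kappa>\<^sub>0 \<kappa>\<^sub>1 \<alpha> z t"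
proof -
  let ?R = "ts_from T t0" and ?S = "ts_from (ts_kappa T) t0"
    and ?S' = "ts_from (ts_kappa (ts_kappa T)) t0"
  let ?C = "conf_deriv ?R \<kappa>\<^sub>0 \<kappa>\<^sub>1 \<alpha>"
  have R: "closed ?R" and S: "closed ?S"
    using T closed_ts_kappa closed_ts_from by auto
  have SR: "?S \<subseteq> ?R" and S'S: "?S' \<subseteq> ?S"
    by (simp_all add: ts_from_mono ts_kappa_subset)
  have y1: "\<And>t. t \<in> ?S \<Longrightarrow> delta_differentiable ?R y t"
    and y2: "\<And>t. t \<in> ?S' \<Longrightarrow> delta_differentiable ?S (delta_deriv ?R y) t"
    and y3: "\<And>t. t \<in> ?S' \<Longrightarrow> delta_differentiable ?S (?C y) t"
    and y4: "rd_continuous ?S' (delta_deriv ?S (delta_deriv ?R y))"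
    and y5: "\<And>t. t \<in> ?S' \<Longrightarrow> conf_L T t0 \<kappa>\<^sub>0 \<kappa>\<^sub>1 \<alpha> a b y t = 0"
    using y by (auto simp: conf_solution_def C2_rd_def)
  have z1: "\<And>t. t \<in> ?S \<Longrightarrow> delta_differentiable ?R z t"
    and z2: "\<And>t. t \<in> ?S' \<Longrightarrow> delta_differentiable ?S (delta_deriv ?R z) t"
    and z3: "\<And>t. t \<in> ?S' \<Longrightarrow> delta_differentiable ?S (?C z) t"
    and z4: "rd_continuous ?S' (delta_deriv ?S (delta_deriv ?R z))"
    and z5: "\<And>t. t \<in> ?S' \<Longrightarrow> conf_L T t0 \<kappa>\<^sub>0 \<kappa>\<^sub>1 \<alpha> a b z t = 0"
    using z by (auto simp: conf_solution_def C2_rd_def)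
  have h0: "\<And>s. h s = c * y s + d * z s" by (simp add: h_def)
  have h1: "delta_differentiable ?R h t"
    "delta_deriv ?R h t = c * delta_deriv ?R y t + d * delta_deriv ?R z t" if "t \<in> ?S" for t
    using delta_deriv_lincomb[OF y1[OF that] z1[OF that] R _ h0] that SR by auto
  have h2: "delta_differentiable ?S (delta_deriv ?R h) t"
    "delta_deriv ?S (delta_deriv ?R h) t
       = c * delta_deriv ?S (delta_deriv ?R y) t + d * delta_deriv ?S (delta_deriv ?R z) t"
    if "t \<in> ?S'" for t
    using delta_deriv_lincomb[OF y2[OF that] z2[OF that] S _ h1(2)] that S'S by auto
  show hC: "?C h t = c * ?C y t + d * ?C z t" if "t \<in> ?S" for t
    using conf_deriv_lincomb[OF R _ y1[OF that] z1[OF that] h0] that SR by auto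
  have h3: "delta_differentiable ?S (?C h) t" if "t \<in> ?S'" for t
    using delta_deriv_lincomb(1)[OF y3[OF that] z3[OF that] S _ hC] that S'S by auto
  have h5: "conf_L T t0 \<kappa>\<^sub>0 \<kappa>\<^sub>1 \<alpha> a b h t = 0" if t: "t \<in> ?S'" for t
  proof -
    have tS: "t \<in> ?S" using t S'S by auto
    have "conf_L T t0 \<kappa>\<^sub>0 \<kappa>\<^sub>1 \<alpha> a b h t
        = c * conf_L T t0 \<kappa>\<^sub>0 \<kappa>\<^sub>1 \<alpha> a b y t + d * conf_L T t0 \<kappa>\<^sub>0 \<kappa>\<^sub>1 \<alpha> a b z t"
      using conf_deriv_lincomb[OF S tS y3[OF t] z3[OF t] hC] hC[OF tS]
      by (simp add: conf_L_def h0 algebra_simps)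
    then show ?thesis using y5 z5 t by simp
  qed
  show "conf_solution T t0 \<kappa>\<^sub>0 \<kappa>\<^sub>1 \<alpha> a b h"
    unfolding conf_solution_def C2_rd_def
    using h1(1) h2(1) h3 h5 rd_continuous_lincomb[OF y4 z4 h2(2)] by auto
qed

section \<open>Uniqueness\<close>

text \<open>
  With \<open>v\<close> the first conformable derivative, \<open>v = \<kappa>\<^sub>1 u + \<kappa>\<^sub>0 u\<^sup>\<Delta>\<close> and the equation itself are solved for
  \<open>u\<^sup>\<Delta>\<close> and \<open>v\<^sup>\<Delta>\<close>, which turns \<open>u\<close>, \<open>v\<close> into a solution of a linear system with continuous
  coefficients on \<open>ts_kappa T\<close>.
\<close>
lemma conf_solution_zero:
  assumes T: "closed T" and t0: "t0 \<in> ts_kappa T"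
    and \<kappa>0: "\<And>t. t \<in> ts_kappa T \<Longrightarrow> \<kappa>\<^sub>0 \<alpha> t \<noteq> 0"
    and diff: "\<And>t. t \<in> ts_kappa T \<Longrightarrow> delta_differentiable T (\<kappa>\<^sub>0 \<alpha>) t"
      "\<And>t. t \<in> ts_kappa T \<Longrightarrow> delta_differentiable T (\<kappa>\<^sub>1 \<alpha>) t"
    and sol: "conf_solution T t0 \<kappa>\<^sub>0 \<kappa>\<^sub>1 \<alpha> a b u"
    and zero: "u t0 = 0" "conf_deriv (ts_from T t0) \<kappa>\<^sub>0 \<kappa>\<^sub>1 \<alpha> u t0 = 0"
    and x: "x \<in> ts_from T t0"
  shows "u x = 0"
proof -
  let ?R = "ts_from T t0" and ?S = "ts_from (ts_kappa T) t0"
    and ?S' = "ts_from (ts_kappa (ts_kappa T)) t0"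
  define v where "v = conf_deriv ?R \<kappa>\<^sub>0 \<kappa>\<^sub>1 \<alpha> u"
  have S: "closed ?S" "t0 \<in> ?S" "\<And>s. s \<in> ?S \<Longrightarrow> t0 \<le> s"
    using T t0 closed_ts_kappa closed_ts_from by (auto simp: ts_from_def)
  have SR: "?S \<subseteq> ?R" and SK: "?S \<subseteq> ts_kappa T"
    by (simp_all add: ts_from_mono ts_kappa_subset) (simp add: ts_from_def)
  have u': "has_delta_deriv ?R u (delta_deriv ?R u t) t" if "t \<in> ?S" for t
    using sol that by (auto simp: conf_solution_def C2_rd_def intro: has_delta_deriv_delta_deriv)
  have v': "has_delta_deriv ?S v (delta_deriv ?S v t) t" if "t \<in> ?S'" for t
    using sol that by (auto simp: conf_solution_def v_def intro: has_delta_deriv_delta_deriv)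
  define du where "du t = (v t - \<kappa>\<^sub>1 \<alpha> t * u t) / \<kappa>\<^sub>0 \<alpha> t" for t
  define dv where "dv t = - (b * u t + (a + \<kappa>\<^sub>1 \<alpha> t) * v t) / \<kappa>\<^sub>0 \<alpha> t" for t
  have du_eq: "delta_deriv ?R u t = du t" if "t \<in> ?S" for t
  proof -
    have "v t = \<kappa>\<^sub>1 \<alpha> t * u t + \<kappa>\<^sub>0 \<alpha> t * delta_deriv ?R u t" by (simp add: v_def conf_deriv_def)
    moreover have "\<kappa>\<^sub>0 \<alpha> t \<noteq> 0" using that SK \<kappa>0 by auto
    ultimately show ?thesis by (simp add: du_def field_simps)
  qed
  have dv_eq: "delta_deriv ?S v t = dv t" if "t \<in> ?S'" for t
  proof -
    have "conf_L T t0 \<kappa>\<^sub>0 \<kappa>\<^sub>1 \<alpha> a b u t = 0" using sol that by (simp add: conf_solution_def)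
    then have "\<kappa>\<^sub>1 \<alpha> t * v t + \<kappa>\<^sub>0 \<alpha> t * delta_deriv ?S v t + a * v t + b * u t = 0"
      by (simp add: conf_L_def conf_deriv_def[of ?S] flip: v_def)
    then have "\<kappa>\<^sub>0 \<alpha> t * delta_deriv ?S v t = - (b * u t + (a + \<kappa>\<^sub>1 \<alpha> t) * v t)"
      by (simp add: algebra_simps)
    moreover have "\<kappa>\<^sub>0 \<alpha> t \<noteq> 0" using that SK \<kappa>0 ts_kappa_subset by (auto simp: ts_from_def)
    ultimately show ?thesis unfolding dv_def by (metis nonzero_mult_div_cancel_left)
  qed
  have nonmax: "t \<in> ?S'" if "t \<in> ?S" "r \<in> ?S" "t < r" for t r
    using that not_max_in_ts_kappa[of t "ts_kappa T" r] by (auto simp: ts_from_def)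
  have cu: "continuous_on ?S u"
    unfolding continuous_on_eq_continuous_within
    using has_delta_deriv_imp_continuous[OF u'] SR by (blast intro: continuous_within_subset)
  have cv: "continuous_on ?S v"
    unfolding continuous_on_eq_continuous_within
  proof
    fix t assume t: "t \<in> ?S"
    show "continuous (at t within ?S) v"
    proof (cases "t \<in> ?S'")
      case True
      then show ?thesis using has_delta_deriv_imp_continuous[OF v'] t by blast
    next
      case False
      \<comment> \<open>Here \<open>t\<close> is the left-scattered maximum of \<open>ts_kappa T\<close>, an isolated point.\<close>
      have tK: "t \<in> ts_kappa T" "t \<notin> ts_kappa (ts_kappa T)"
        using t False by (auto simp: ts_from_def)
      note rem = removed_point[OF tK]
      have "?S \<inter> {bwd_jump (ts_kappa T) t<..} \<subseteq> {t}"
        using rem(1) le_bwd_jump[of _ "ts_kappa T" t] by (force simp: ts_from_def)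
      moreover have "t \<in> {bwd_jump (ts_kappa T) t<..}" using rem(2) by simp
      ultimately have "\<not> t islimpt ?S"
        unfolding islimpt_def by (meson Int_iff open_greaterThan singletonD subsetD)
      then show ?thesis
        by (simp add: continuous_trivial_limit trivial_limit_within)
    qed
  qed
  define k where "k t = (1 + \<bar>a\<bar> + \<bar>b\<bar> + 2 * \<bar>\<kappa>\<^sub>1 \<alpha> t\<bar>) / \<bar>\<kappa>\<^sub>0 \<alpha> t\<bar>" for t
  have c\<kappa>: "continuous_on ?S (\<kappa>\<^sub>0 \<alpha>)" "continuous_on ?S (\<kappa>\<^sub>1 \<alpha>)"
    unfolding continuous_on_eq_continuous_within
    using diff[THEN has_delta_deriv_delta_deriv, THEN has_delta_deriv_imp_continuous]
      SK ts_kappa_subset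
    by (meson continuous_within_subset subset_iff subset_trans)+
  have ck: "continuous_on ?S k"
    unfolding k_def using c\<kappa> \<kappa>0 SK by (intro continuous_intros) auto
  have bound: "\<bar>du t\<bar> + \<bar>dv t\<bar> \<le> k t * (\<bar>u t\<bar> + \<bar>v t\<bar>)" for t
  proof -
    have "\<bar>v t - \<kappa>\<^sub>1 \<alpha> t * u t\<bar> \<le> \<bar>v t\<bar> + \<bar>\<kappa>\<^sub>1 \<alpha> t\<bar> * \<bar>u t\<bar>"
      by (metis abs_mult abs_triangle_ineq4)
    moreover have "\<bar>b * u t + (a + \<kappa>\<^sub>1 \<alpha> t) * v t\<bar> \<le> \<bar>b\<bar> * \<bar>u t\<bar> + (\<bar>a\<bar> + \<bar>\<kappa>\<^sub>1 \<alpha> t\<bar>) * \<bar>v t\<bar>"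
      by (rule order_trans[OF abs_triangle_ineq]) (auto simp: abs_mult intro!: mult_right_mono)
    moreover have "0 \<le> \<bar>u t\<bar> + \<bar>a\<bar> * \<bar>u t\<bar> + \<bar>b\<bar> * \<bar>v t\<bar> + \<bar>\<kappa>\<^sub>1 \<alpha> t\<bar> * \<bar>u t\<bar> + \<bar>\<kappa>\<^sub>1 \<alpha> t\<bar> * \<bar>v t\<bar>"
      by simp
    ultimately have "\<bar>v t - \<kappa>\<^sub>1 \<alpha> t * u t\<bar> + \<bar>b * u t + (a + \<kappa>\<^sub>1 \<alpha> t) * v t\<bar>
        \<le> (\<bar>v t\<bar> + \<bar>\<kappa>\<^sub>1 \<alpha> t\<bar> * \<bar>u t\<bar>) + (\<bar>b\<bar> * \<bar>u t\<bar> + (\<bar>a\<bar> + \<bar>\<kappa>\<^sub>1 \<alpha> t\<bar>) * \<bar>v t\<bar>)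
          + (\<bar>u t\<bar> + \<bar>a\<bar> * \<bar>u t\<bar> + \<bar>b\<bar> * \<bar>v t\<bar> + \<bar>\<kappa>\<^sub>1 \<alpha> t\<bar> * \<bar>u t\<bar> + \<bar>\<kappa>\<^sub>1 \<alpha> t\<bar> * \<bar>v t\<bar>)"
      by (meson add_mono add_increasing2)
    also have "\<dots> = (1 + \<bar>a\<bar> + \<bar>b\<bar> + 2 * \<bar>\<kappa>\<^sub>1 \<alpha> t\<bar>) * (\<bar>u t\<bar> + \<bar>v t\<bar>)"
      by (simp add: algebra_simps)
    finally have "\<bar>v t - \<kappa>\<^sub>1 \<alpha> t * u t\<bar> + \<bar>b * u t + (a + \<kappa>\<^sub>1 \<alpha> t) * v t\<bar>
        \<le> (1 + \<bar>a\<bar> + \<bar>b\<bar> + 2 * \<bar>\<kappa>\<^sub>1 \<alpha> t\<bar>) * (\<bar>u t\<bar> + \<bar>v t\<bar>)" .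
    then show ?thesis
      unfolding du_def dv_def k_def
      by (simp only: abs_divide abs_minus_cancel times_divide_eq_left divide_right_mono abs_ge_zero
          flip: add_divide_distrib)
  qed
  have duS: "has_delta_deriv ?S u (du t) t" if "t \<in> ?S" "r \<in> ?S" "t < r" for t r
    using has_delta_deriv_subset[OF u'[OF that(1)] SR fwd_jump_ts_from_ts_kappa[OF that(2,3)]]
      du_eq[OF that(1)] by simp
  have dvS: "has_delta_deriv ?S v (dv t) t" if "t \<in> ?S" "r \<in> ?S" "t < r" for t r
    using v'[OF nonmax[OF that]] dv_eq[OF nonmax[OF that]] by simp
  have v0: "v t0 = 0" using zero(2) by (simp add: v_def)
  have uvS: "u s = 0 \<and> v s = 0" if "s \<in> ?S" for s
    using gronwall_zero[OF S zero(1) v0 cu cv ck _ _ bound that] duS dvS by blast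
  show ?thesis
  proof (cases "x \<in> ?S")
    case True
    then show ?thesis using uvS by blast
  next
    case False
    then have xT: "x \<in> T" "x \<notin> ts_kappa T" using x by (auto simp: ts_from_def)
    note rem = removed_point[OF xT]
    \<comment> \<open>\<open>x\<close> is the left-scattered maximum of \<open>T\<close>, and \<open>p\<close> is the point before the gap.\<close>
    define p where "p = bwd_jump T x"
    have t0x: "t0 \<in> T" "t0 < x"
      using t0 xT(2) rem(1)[of t0] ts_kappa_subset by (auto simp: less_le)
    have p: "p \<in> T" "p < x" "t0 \<le> p"
      using bwd_jump_in[OF T t0x] rem(2) le_bwd_jump[OF t0x] by (auto simp: p_def)
    then have pS: "p \<in> ?S" using rem(3) by (auto simp: ts_from_def)
    have jump: "fwd_jump ?R p = x"
    proof (rule fwd_jump_eqI[OF x p(2)])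
      show "x \<le> s" if "s \<in> ?R" "p < s" for s
        using that le_bwd_jump[of s T x] by (force simp: ts_from_def p_def)
    qed
    have u'p: "has_delta_deriv ?R u 0 p"
      using u'[OF pS] du_eq[OF pS] uvS[OF pS] by (simp add: du_def)
    have pR: "p \<in> ?R" using pS SR by blast
    have "\<bar>u x\<bar> \<le> 0 + e" if "e > 0" for e
    proof -
      have "e / (x - p) > 0" using that p by simp
      from has_delta_deriv_forward[OF u'p pR this x p(2)]
      have "\<bar>u x - u p - 0 * (x - p)\<bar> \<le> e / (x - p) * (x - p)"
        using x p(2) jump by blast
      then show ?thesis using uvS[OF pS] p(2) by simp
    qed
    then have "\<bar>u x\<bar> \<le> 0" by (rule field_le_epsilon)
    then show ?thesis by simp
  qed
qed

section \<open>The initial value problem\<close>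

theorem theorem3p16:
  fixes T :: "real set" and \<alpha> a b t0 y0 y0\<alpha> :: real
    and \<kappa>\<^sub>0 \<kappa>\<^sub>1 :: "real \<Rightarrow> real \<Rightarrow> real"
  assumes "time_scale T"
    and "\<alpha> \<in> {0..1}"
    and "t0 \<in> ts_kappa T"
    and "admissible_pair T \<kappa>\<^sub>0 \<kappa>\<^sub>1"
    and "\<forall>t \<in> ts_kappa T. \<kappa>\<^sub>0 \<alpha> t \<noteq> 0 \<and> 1 + graininess T t * (\<kappa>\<^sub>1 \<alpha> t / \<kappa>\<^sub>0 \<alpha> t) \<noteq> 0"
    and "\<forall>t \<in> ts_kappa T. delta_differentiable T (\<kappa>\<^sub>0 \<alpha>) t \<and> delta_differentiable T (\<kappa>\<^sub>1 \<alpha>) t"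
    and "\<forall>t \<in> T. continuous_on {0..1} (\<lambda>\<beta>. \<kappa>\<^sub>0 \<beta> t) \<and> continuous_on {0..1} (\<lambda>\<beta>. \<kappa>\<^sub>1 \<beta> t)"
    and "\<forall>t \<in> ts_kappa T.
           (\<kappa>\<^sub>0 \<alpha> t)\<^sup>2 - graininess T t * \<kappa>\<^sub>0 \<alpha> t * (a + 2 * \<kappa>\<^sub>1 \<alpha> t)
             + (graininess T t)\<^sup>2 * (b + a * \<kappa>\<^sub>1 \<alpha> t + (\<kappa>\<^sub>1 \<alpha> t)\<^sup>2) \<noteq> 0"
    and "\<exists>y1 y2. conf_solution T t0 \<kappa>\<^sub>0 \<kappa>\<^sub>1 \<alpha> a b y1 \<and> conf_solution T t0 \<kappa>\<^sub>0 \<kappa>\<^sub>1 \<alpha> a b y2 \<and>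
           (\<forall>t \<in> ts_from (ts_kappa (ts_kappa T)) t0.
              y1 t * conf_deriv (ts_from T t0) \<kappa>\<^sub>0 \<kappa>\<^sub>1 \<alpha> y2 t
                \<noteq> conf_deriv (ts_from T t0) \<kappa>\<^sub>0 \<kappa>\<^sub>1 \<alpha> y1 t * y2 t)"
  shows "\<exists>y. conf_ivp_solution T t0 \<kappa>\<^sub>0 \<kappa>\<^sub>1 \<alpha> a b y0 y0\<alpha> y \<and>
           (\<forall>z. conf_ivp_solution T t0 \<kappa>\<^sub>0 \<kappa>\<^sub>1 \<alpha> a b y0 y0\<alpha> z \<longrightarrow> (\<forall>t \<in> ts_from T t0. z t = y t))"
proof -
  let ?R = "ts_from T t0" and ?S = "ts_from (ts_kappa T) t0"
    and ?S' = "ts_from (ts_kappa (ts_kappa T)) t0"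
  let ?C = "conf_deriv ?R \<kappa>\<^sub>0 \<kappa>\<^sub>1 \<alpha>"
  have T: "closed T" using assms(1) by (simp add: time_scale_def)
  have t0S: "t0 \<in> ?S" using assms(3) by (simp add: ts_from_def)
  obtain y1 y2 where y1: "conf_solution T t0 \<kappa>\<^sub>0 \<kappa>\<^sub>1 \<alpha> a b y1"
    and y2: "conf_solution T t0 \<kappa>\<^sub>0 \<kappa>\<^sub>1 \<alpha> a b y2"
    and W: "\<And>t. t \<in> ?S' \<Longrightarrow> y1 t * ?C y2 t \<noteq> ?C y1 t * y2 t"
    using assms(9) by blast
  have "\<exists>y. conf_ivp_solution T t0 \<kappa>\<^sub>0 \<kappa>\<^sub>1 \<alpha> a b y0 y0\<alpha> y"
  proof (cases "t0 \<in> ?S'")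
    case True
    define w where "w = y1 t0 * ?C y2 t0 - ?C y1 t0 * y2 t0"
    have w: "w \<noteq> 0" using W[OF True] by (simp add: w_def)
    \<comment> \<open>Cramer's rule for the coefficients of \<open>y1\<close> and \<open>y2\<close>.\<close>
    define c where "c = (y0 * ?C y2 t0 - y0\<alpha> * y2 t0) / w"
    define d where "d = (y1 t0 * y0\<alpha> - ?C y1 t0 * y0) / w"
    have "c * y1 t0 + d * y2 t0 = y0 * w / w"
      unfolding c_def d_def by (simp add: w_def algebra_simps flip: add_divide_distrib)
    moreover have "c * ?C y1 t0 + d * ?C y2 t0 = y0\<alpha> * w / w"
      unfolding c_def d_def by (simp add: w_def algebra_simps flip: add_divide_distrib)
    ultimately have "conf_ivp_solution T t0 \<kappa>\<^sub>0 \<kappa>\<^sub>1 \<alpha> a b y0 y0\<alpha> (\<lambda>s. c * y1 s + d * y2 s)"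
      using conf_solution_lincomb[OF T y1 y2, where c = c and d = d] t0S w by (simp add: conf_ivp_solution_def)
    then show ?thesis by blast
  next
    case False
    then have "t0 \<notin> ts_kappa (ts_kappa T)" by (simp add: ts_from_def)
    note rem = removed_point[OF assms(3) this]
    have S: "?S = {t0}" and S': "?S' = {}"
      using rem assms(3) by (auto simp: ts_from_def intro: antisym)
    define D where "D = (y0\<alpha> - \<kappa>\<^sub>1 \<alpha> t0 * y0) / \<kappa>\<^sub>0 \<alpha> t0"
    define y where "y s = y0 + D * (s - t0)" for s
    have "delta_differentiable ?R y1 t0"
      using y1 t0S by (simp add: conf_solution_def C2_rd_def)
    moreover have "has_delta_deriv ?R y D t0"
      unfolding y_def by (rule has_delta_deriv_affine)
    ultimately have y: "delta_differentiable ?R y t0" "delta_deriv ?R y t0 = D"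
      by (rule delta_differentiable_transfer)+
    have "?C y t0 = y0\<alpha>"
      using assms(3,5) y(2) by (simp add: conf_deriv_def y_def D_def)
    then have "conf_ivp_solution T t0 \<kappa>\<^sub>0 \<kappa>\<^sub>1 \<alpha> a b y0 y0\<alpha> y"
      unfolding conf_ivp_solution_def conf_solution_def C2_rd_def S S'
      using y(1) by (simp add: rd_continuous_def) (simp add: y_def)
    then show ?thesis by blast
  qed
  then obtain y where y: "conf_ivp_solution T t0 \<kappa>\<^sub>0 \<kappa>\<^sub>1 \<alpha> a b y0 y0\<alpha> y" ..
  have "z t = y t" if z: "conf_ivp_solution T t0 \<kappa>\<^sub>0 \<kappa>\<^sub>1 \<alpha> a b y0 y0\<alpha> z" and t: "t \<in> ?R" for z t
  proof -
    have sol: "conf_solution T t0 \<kappa>\<^sub>0 \<kappa>\<^sub>1 \<alpha> a b z" "conf_solution T t0 \<kappa>\<^sub>0 \<kappa>\<^sub>1 \<alpha> a b y"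
      using y z by (auto simp: conf_ivp_solution_def)
    note diff = conf_solution_lincomb[OF T sol, where c = 1 and d = "-1"]
    have "?C (\<lambda>s. 1 * z s + (-1) * y s) t0 = 0"
      using diff(2)[OF t0S] y z by (simp add: conf_ivp_solution_def)
    moreover have "1 * z t0 + (-1) * y t0 = 0" using y z by (simp add: conf_ivp_solution_def)
    ultimately have "1 * z t + (-1) * y t = 0"
      using assms(5,6) by (intro conf_solution_zero[OF T assms(3) _ _ _ diff(1) _ _ t]) auto
    then show ?thesis by simp
  qed
  with y show ?thesis by blast
qed

end
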